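(* Let $d \in \mathbb{N}$ and let $F : \mathbb{R} \to [0,1]$ be a cumulative distribution function. For each $x \in \mathbb{R}$ and $\varepsilon \geq 0$, $$\max_{\mathbb{P} \in \mathcal{P}_d^{\mathrm{c}}(F)} \mathbb{P}\Bigl( x < \max_{i \in [d]} X_i \leq x + \varepsilon \Bigr) = \bigl( F(x+\varepsilon) - F(x) \bigr) \biggl\{ \frac{1}{1 - F(x)} \land d \biggr\}.$$ In particular, the maximum is attained.
   Context: $\mathbb{N} = \{1,2,\ldots\}$ and $[d] = \{1,\ldots,d\}$. For $a,b$, $a \land b$ is their minimum. When $F(x) = 1$, $\frac{1}{1-F(x)}$ is read as $+\infty$, so that the braces equal $d$ (and the right-hand side is $0$). A $d$-dimensional copula is the restriction to $[0,1]^d$ of the joint cumulative distribution function (CDF) of a random vector $(U_1,\ldots,U_d)$ each of whose coordinates is uniformly distributed on $[0,1]$. For a CDF $F$ on $\mathbb{R}$, $\mathcal{P}_d^{\mathrm{c}}(F)$ denotes the set of probability distributions $\mathbb{P}$ on $\mathbb{R}^d$ whose joint CDF has the form $\mathbb{P}(X_1 \leq x_1, \ldots, X_d \leq x_d) = C\bigl(F(x_1), \ldots, F(x_d)\bigr)$ for all $(x_1,\ldots,x_d) \in \mathbb{R}^d$, where $C$ is a $d$-dimensional copula for which the diagonal section $\Delta : [0,1] \to [0,1]$, $\Delta(u) = C(u,\ldots,u)$, is a convex function; here $(X_1,\ldots,X_d)$ denotes a random vector with law $\mathbb{P}$. *)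

theory Defs
  imports "HOL-Probability.Probability"
begin

(* Points of R^d are functions on the index set {1..d}; the Borel sigma-algebra of R^d is
   the product sigma-algebra, so elements of the space are undefined outside {1..d}. *)
abbreviation borel_Rd :: "nat \<Rightarrow> (nat \<Rightarrow> real) measure" where
  "borel_Rd d \<equiv> \<Pi>\<^sub>M i\<in>{1..d}. (borel :: real measure)"

definition law_on_Rd :: "nat \<Rightarrow> (nat \<Rightarrow> real) measure \<Rightarrow> bool" where
  "law_on_Rd d P \<longleftrightarrow> prob_space P \<and> sets P = sets (borel_Rd d)"

definition joint_cdf :: "nat \<Rightarrow> (nat \<Rightarrow> real) measure \<Rightarrow> (nat \<Rightarrow> real) \<Rightarrow> real" where
  "joint_cdf d P x = measure P {X \<in> space P. \<forall>i\<in>{1..d}. X i \<le> x i}"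

(* A copula is a function on the cube [0,1]^d only; as an element of the function type it is
   undefined off the cube. The random vector (U_1, ..., U_d) is represented by its law Q. *)
definition copula :: "nat \<Rightarrow> ((nat \<Rightarrow> real) \<Rightarrow> real) \<Rightarrow> bool" where
  "copula d C \<longleftrightarrow>
     (\<exists>Q. law_on_Rd d Q \<and>
          (\<forall>i\<in>{1..d}. distr Q borel (\<lambda>U. U i) = uniform_measure lborel {0..1}) \<and>
          C = restrict (joint_cdf d Q) ({1..d} \<rightarrow>\<^sub>E {0..1}))"

definition diagonal_section :: "nat \<Rightarrow> ((nat \<Rightarrow> real) \<Rightarrow> real) \<Rightarrow> real \<Rightarrow> real" where
  "diagonal_section d C u = C (\<lambda>i\<in>{1..d}. u)"

definition convex_diagonal_laws :: "nat \<Rightarrow> (real \<Rightarrow> real) \<Rightarrow> (nat \<Rightarrow> real) measure set" where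
  "convex_diagonal_laws d F =
     {P. law_on_Rd d P \<and>
         (\<exists>C. copula d C \<and> convex_on {0..1} (diagonal_section d C) \<and>
              (\<forall>x. joint_cdf d P x = C (\<lambda>i\<in>{1..d}. F (x i))))}"

end

theory Submission
  imports Defs
begin

text \<open>
  Let \<open>\<Delta>\<close> be the diagonal section of the copula. The event in question has probability
  \<open>\<Delta> b - \<Delta> a\<close> with \<open>a = F x\<close> and \<open>b = F (x + \<epsilon>)\<close>, so the theorem is about the increments of
  convex diagonal sections.

  Upper bound. By the union bound, \<open>\<Delta>\<close> is Lipschitz with constant \<open>d\<close>
  (\<open>joint_cdf_diagonal_lipschitz\<close>). If \<open>a < 1\<close>, then by convexity its slope between \<open>a\<close> and \<open>b\<close> is
  at most its slope between \<open>a\<close> and \<open>1\<close>, which is at most \<open>1 / (1 - a)\<close> because \<open>\<Delta> a \<ge> 0\<close> and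
  \<open>\<Delta> 1 = 1\<close> (\<open>convex_increment_le\<close>). If \<open>a = 1\<close>, then \<open>b = 1\<close> and both sides vanish.

  Attainment. It suffices to have, for each \<open>t\<close> with \<open>0 \<le> t \<le> 1 - 1 / d\<close>, a copula with diagonal
  section \<open>u \<mapsto> max 0 ((u - t) / (1 - t))\<close>, and to take \<open>t = min a (1 - 1 / d)\<close>: the slope on \<open>[t, 1]\<close> is
  \<open>1 / (1 - t) = min (1 / (1 - a)) d\<close> when \<open>a < 1\<close>, and \<open>d\<close> when \<open>a = 1\<close>. For this, take a
  uniform variable \<open>W\<close> on \<open>(0, 1)\<close> and an independent random nonempty set \<open>S\<close> of indices that
  contains each index with probability \<open>1 - t\<close> (\<open>exists_random_subset\<close>); such a set exists since
  \<open>1 - t \<ge> 1 / d\<close>. Put \<open>U\<^sub>i = t + (1 - t) W\<close> if \<open>i \<in> S\<close> and \<open>U\<^sub>i = t W\<close> otherwise. Each \<open>U\<^sub>i\<close> is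
  uniform on \<open>[0, 1]\<close>, and the maximum of the \<open>U\<^sub>i\<close> is \<open>t + (1 - t) W\<close>, which is uniform on
  \<open>[t, 1]\<close> (\<open>exists_law_with_kinked_diagonal\<close>). Composing the coordinates with the quantile
  function of \<open>F\<close> gives the required law (\<open>exists_law_with_copula\<close>).
\<close>

section \<open>Laws of random vectors and their joint distribution functions\<close>

text \<open>The law of the random vector \<open>(X 1, \<dots>, X d)\<close> defined on the probability space \<open>M\<close>.\<close>

definition vector_law :: "nat \<Rightarrow> 'a measure \<Rightarrow> (nat \<Rightarrow> 'a \<Rightarrow> real) \<Rightarrow> (nat \<Rightarrow> real) measure" where
  "vector_law d M X = distr M (borel_Rd d) (\<lambda>\<omega>. \<lambda>i\<in>{1..d}. X i \<omega>)"

lemma coordinate_measurable: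
  assumes "law_on_Rd d P" "i \<in> {1..d}"
  shows "(\<lambda>X. X i) \<in> borel_measurable P"
proof -
  have "sets P = sets (borel_Rd d)" using assms by (simp add: law_on_Rd_def)
  moreover have "(\<lambda>X. X i) \<in> borel_measurable (borel_Rd d)"
    by (rule measurable_component_singleton[OF assms(2)])
  ultimately show ?thesis
    using measurable_cong_sets[of P "borel_Rd d" borel borel] by blast
qed

lemma orthant_measurable:
  assumes "law_on_Rd d P"
  shows "{X \<in> space P. \<forall>i\<in>{1..d}. X i \<le> x i} \<in> sets P"
  using coordinate_measurable[OF assms]
  by (intro sets.sets_Collect_finite_All borel_measurable_le) auto

lemma joint_cdf_cong:
  assumes "\<And>i. i \<in> {1..d} \<Longrightarrow> x i = y i"
  shows "joint_cdf d P x = joint_cdf d P y"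
  unfolding joint_cdf_def using assms by (intro arg_cong[where f = "measure P"]) auto

lemma measurable_vector:
  assumes "\<And>i. i \<in> {1..d} \<Longrightarrow> X i \<in> borel_measurable M"
  shows "(\<lambda>\<omega>. \<lambda>i\<in>{1..d}. X i \<omega>) \<in> measurable M (borel_Rd d)"
  using assms by (rule measurable_restrict)

lemma law_on_Rd_vector_law:
  assumes "prob_space M" "\<And>i. i \<in> {1..d} \<Longrightarrow> X i \<in> borel_measurable M"
  shows "law_on_Rd d (vector_law d M X)"
  unfolding law_on_Rd_def vector_law_def
  using prob_space.prob_space_distr[OF assms(1) measurable_vector[OF assms(2)]] by simp

lemma joint_cdf_vector_law:
  assumes "prob_space M" "\<And>i. i \<in> {1..d} \<Longrightarrow> X i \<in> borel_measurable M"
  shows "joint_cdf d (vector_law d M X) x = measure M {\<omega> \<in> space M. \<forall>i\<in>{1..d}. X i \<omega> \<le> x i}"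
proof -
  let ?P = "vector_law d M X"
  have meas: "{Y \<in> space ?P. \<forall>i\<in>{1..d}. Y i \<le> x i} \<in> sets (borel_Rd d)"
    using orthant_measurable[OF law_on_Rd_vector_law[OF assms]] by (simp add: vector_law_def)
  have "joint_cdf d ?P x = measure M ((\<lambda>\<omega>. \<lambda>i\<in>{1..d}. X i \<omega>) -` {Y \<in> space ?P. \<forall>i\<in>{1..d}. Y i \<le> x i} \<inter> space M)"
    using measure_distr[OF measurable_vector[OF assms(2)] meas]
    by (simp add: joint_cdf_def vector_law_def)
  also have "(\<lambda>\<omega>. \<lambda>i\<in>{1..d}. X i \<omega>) -` {Y \<in> space ?P. \<forall>i\<in>{1..d}. Y i \<le> x i} \<inter> space M
      = {\<omega> \<in> space M. \<forall>i\<in>{1..d}. X i \<omega> \<le> x i}"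
    by (auto simp: vector_law_def space_PiM)
  finally show ?thesis .
qed

lemma distr_coordinate_vector_law:
  assumes "\<And>i. i \<in> {1..d} \<Longrightarrow> X i \<in> borel_measurable M" "i \<in> {1..d}"
  shows "distr (vector_law d M X) borel (\<lambda>Y. Y i) = distr M borel (X i)"
proof -
  have "distr (vector_law d M X) borel (\<lambda>Y. Y i)
      = distr M borel ((\<lambda>Y. Y i) \<circ> (\<lambda>\<omega>. \<lambda>i\<in>{1..d}. X i \<omega>))"
    unfolding vector_law_def
    by (rule distr_distr[OF measurable_component_singleton[OF assms(2)] measurable_vector[OF assms(1)]])
  also have "(\<lambda>Y. Y i) \<circ> (\<lambda>\<omega>. \<lambda>i\<in>{1..d}. X i \<omega>) = X i"
    using assms(2) by (auto simp: comp_def)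
  finally show ?thesis .
qed

text \<open>The probability that the largest coordinate falls into an interval is an increment of the
  joint distribution function along the diagonal.\<close>

lemma measure_Max_in_interval:
  assumes P: "law_on_Rd d P" and "d \<ge> 1" and "y \<le> z"
  shows "measure P {X \<in> space P. y < Max (X ` {1..d}) \<and> Max (X ` {1..d}) \<le> z}
    = joint_cdf d P (\<lambda>_. z) - joint_cdf d P (\<lambda>_. y)"
proof -
  interpret prob_space P using P by (simp add: law_on_Rd_def)
  let ?A = "\<lambda>c. {X \<in> space P. \<forall>i\<in>{1..d}. X i \<le> c}"
  have Max_le: "Max (X ` {1..d}) \<le> c \<longleftrightarrow> (\<forall>i\<in>{1..d}. X i \<le> c)" for X :: "nat \<Rightarrow> real" and c
    using \<open>d \<ge> 1\<close> by (subst Max_le_iff) auto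
  have "{X \<in> space P. y < Max (X ` {1..d}) \<and> Max (X ` {1..d}) \<le> z} = ?A z - ?A y"
    using Max_le by (auto simp: not_le[symmetric])
  moreover have "measure P (?A z - ?A y) = measure P (?A z) - measure P (?A y)"
    using \<open>y \<le> z\<close> by (intro finite_measure_Diff orthant_measurable[OF P]) force
  ultimately show ?thesis by (simp add: joint_cdf_def)
qed

section \<open>Uniform marginals\<close>

lemma real_distribution_uniform: "real_distribution (uniform_measure lborel {0..1::real})"
proof -
  have "prob_space (uniform_measure lborel {0..1::real})"
    by (rule prob_space_uniform_measure) auto
  then show ?thesis
    by (simp add: real_distribution_def real_distribution_axioms_def)
qed

lemma measure_uniform_marginal:
  assumes "law_on_Rd d Q" "i \<in> {1..d}"
    and "distr Q borel (\<lambda>U. U i) = uniform_measure lborel {0..1::real}"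
    and "A \<in> sets borel"
  shows "measure Q {U \<in> space Q. U i \<in> A} = measure lborel ({0..1} \<inter> A)"
proof -
  have "measure Q {U \<in> space Q. U i \<in> A} = measure (distr Q borel (\<lambda>U. U i)) A"
    using assms(4) coordinate_measurable[OF assms(1,2)]
    by (subst measure_distr) (auto intro!: arg_cong[where f = "measure Q"])
  also have "\<dots> = measure lborel ({0..1} \<inter> A)"
    using assms(4) by (simp add: assms(3) measure_uniform_measure)
  finally show ?thesis .
qed

lemma AE_uniform_marginal:
  assumes "law_on_Rd d Q" "i \<in> {1..d}"
    and "distr Q borel (\<lambda>U. U i) = uniform_measure lborel {0..1::real}"
  shows "AE U in Q. 0 < U i \<and> U i < 1"
proof -
  interpret prob_space Q using assms(1) by (simp add: law_on_Rd_def)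
  have "prob {U \<in> space Q. U i \<in> {0<..<1}} = measure lborel ({0..1} \<inter> {0<..<1::real})"
    by (rule measure_uniform_marginal[OF assms]) simp
  also have "{0..1} \<inter> {0<..<1} = {0<..<1::real}" by auto
  finally have "prob {U \<in> space Q. 0 < U i \<and> U i < 1} = 1" by simp
  then show ?thesis
    using coordinate_measurable[OF assms(1,2)] by (subst (asm) prob_Collect_eq_1) auto
qed

lemma joint_cdf_diagonal_one:
  assumes "law_on_Rd d Q"
    and "\<forall>i\<in>{1..d}. distr Q borel (\<lambda>U. U i) = uniform_measure lborel {0..1::real}"
  shows "joint_cdf d Q (\<lambda>_. 1) = 1"
proof -
  interpret prob_space Q using assms(1) by (simp add: law_on_Rd_def)
  have "AE U in Q. \<forall>i\<in>{1..d}. 0 < U i \<and> U i < 1"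
    using AE_uniform_marginal[OF assms(1)] assms(2) by (intro AE_finite_allI) auto
  then have "AE U in Q. \<forall>i\<in>{1..d}. U i \<le> 1" by eventually_elim auto
  then show ?thesis
    using orthant_measurable[OF assms(1)] by (simp add: joint_cdf_def prob_Collect_eq_1)
qed

lemma joint_cdf_diagonal_lipschitz:
  assumes Q: "law_on_Rd d Q"
    and unif: "\<forall>i\<in>{1..d}. distr Q borel (\<lambda>U. U i) = uniform_measure lborel {0..1::real}"
    and ab: "0 \<le> a" "a \<le> b" "b \<le> 1"
  shows "joint_cdf d Q (\<lambda>_. b) - joint_cdf d Q (\<lambda>_. a) \<le> real d * (b - a)"
proof -
  interpret prob_space Q using Q by (simp add: law_on_Rd_def)
  let ?A = "\<lambda>c. {X \<in> space Q. \<forall>i\<in>{1..d}. X i \<le> c}"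
  let ?B = "\<lambda>i. {U \<in> space Q. U i \<in> {a<..b}}"
  have B: "?B i \<in> events" if "i \<in> {1..d}" for i
    using coordinate_measurable[OF Q that] by measurable
  have "prob (?A b) - prob (?A a) = prob (?A b - ?A a)"
    using ab by (intro finite_measure_Diff[symmetric] orthant_measurable[OF Q]) force
  also have "\<dots> \<le> prob (\<Union>i\<in>{1..d}. ?B i)"
    using B by (intro finite_measure_mono sets.finite_UN) (auto simp: not_le)
  also have "\<dots> \<le> (\<Sum>i\<in>{1..d}. prob (?B i))"
    using B by (intro finite_measure_subadditive_finite) auto
  also have "\<dots> = (\<Sum>i\<in>{1..d}. b - a)"
  proof (rule sum.cong[OF refl])
    fix i assume i: "i \<in> {1..d}"
    have "{0..1} \<inter> {a<..b} = {a<..b}" using ab by auto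
    then show "prob (?B i) = b - a"
      using measure_uniform_marginal[OF Q i, of "{a<..b}"] unif i ab by simp
  qed
  finally show ?thesis by (simp add: joint_cdf_def)
qed

lemma convex_on_transfer:
  assumes "convex_on S f" "\<And>x. x \<in> S \<Longrightarrow> g x = f x"
  shows "convex_on S g"
proof (rule convex_onI)
  show "convex S" using assms(1) by (rule convex_on_imp_convex)
next
  fix s x y assume *: "0 < s" "s < (1::real)" "x \<in> S" "y \<in> S"
  then have "(1 - s) *\<^sub>R x + s *\<^sub>R y \<in> S"
    using convex_on_imp_convex[OF assms(1)] by (simp add: convex_alt)
  then show "g ((1 - s) *\<^sub>R x + s *\<^sub>R y) \<le> (1 - s) * g x + s * g y"
    using * convex_onD[OF assms(1), of s x y] by (simp add: assms(2))
qed

lemma convex_increment_le: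
  fixes f :: "real \<Rightarrow> real"
  assumes "convex_on {0..1} f" "f a \<ge> 0" "f 1 \<le> 1" "0 \<le> a" "a < 1" "a \<le> b" "b \<le> 1"
  shows "f b - f a \<le> (b - a) * (1 / (1 - a))"
proof -
  have "convex_on {a..1} f"
    using assms by (auto intro: convex_on_subset)
  then have "f b \<le> (f 1 - f a) / (1 - a) * (b - a) + f a"
    using assms by (intro convex_onD_Icc') auto
  moreover have "(f 1 - f a) / (1 - a) * (b - a) \<le> 1 / (1 - a) * (b - a)"
    using assms by (intro mult_right_mono divide_right_mono) auto
  ultimately show ?thesis by (simp add: mult.commute)
qed

section \<open>Realizing a copula with given marginals\<close>

text \<open>The easy half of Sklar's theorem for equal marginals: the quantile function of \<open>\<mu>\<close> is applied
  to each coordinate of a vector with uniform marginals.\<close>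

lemma exists_law_with_copula:
  assumes \<mu>: "real_distribution \<mu>" and Q: "law_on_Rd d Q"
    and unif: "\<forall>i\<in>{1..d}. distr Q borel (\<lambda>U. U i) = uniform_measure lborel {0..1::real}"
  shows "\<exists>P. law_on_Rd d P \<and> (\<forall>x. joint_cdf d P x = joint_cdf d Q (\<lambda>i. cdf \<mu> (x i)))"
proof -
  interpret prob_space Q using Q by (simp add: law_on_Rd_def)
  interpret \<mu>: cdf_distribution \<mu> using \<mu> by (simp add: cdf_distribution_def)
  \<comment> \<open>The quantile function is only meaningful on the open unit interval; elsewhere any measurable
    extension will do, since the marginals do not charge the rest.\<close>
  define q where "q = (\<lambda>u. if u \<in> {0<..<1} then \<mu>.I u else 0)"
  have q: "q \<in> borel_measurable borel"
    unfolding q_def using \<mu>.measurable_CI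
    by (subst (asm) measurable_restrict_space_iff[where c = 0]) auto
  define X where "X = (\<lambda>i (U :: nat \<Rightarrow> real). q (U i))"
  have X: "X i \<in> borel_measurable Q" if "i \<in> {1..d}" for i
    unfolding X_def using measurable_compose[OF coordinate_measurable[OF Q that] q] .
  have "joint_cdf d (vector_law d Q X) x = joint_cdf d Q (\<lambda>i. cdf \<mu> (x i))" for x
  proof -
    have "AE U in Q. \<forall>i\<in>{1..d}. 0 < U i \<and> U i < 1"
      using AE_uniform_marginal[OF Q] unif by (intro AE_finite_allI) auto
    then have "AE U in Q. (\<forall>i\<in>{1..d}. X i U \<le> x i) \<longleftrightarrow> (\<forall>i\<in>{1..d}. U i \<le> cdf \<mu> (x i))"
      by eventually_elim (auto simp: X_def q_def \<mu>.pseudoinverse[symmetric])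
    moreover have "{U \<in> space Q. \<forall>i\<in>{1..d}. X i U \<le> x i} \<in> sets Q"
      using X by (intro sets.sets_Collect_finite_All borel_measurable_le) auto
    ultimately have "prob {U \<in> space Q. \<forall>i\<in>{1..d}. X i U \<le> x i}
        = prob {U \<in> space Q. \<forall>i\<in>{1..d}. U i \<le> cdf \<mu> (x i)}"
      using orthant_measurable[OF Q] by (intro finite_measure_eq_AE) auto
    then show ?thesis
      using joint_cdf_vector_law[OF prob_space_axioms X] by (simp add: joint_cdf_def)
  qed
  then show ?thesis
    using law_on_Rd_vector_law[OF prob_space_axioms, of d X] X by blast
qed

section \<open>Copulas whose diagonal section has a single kink\<close>

text \<open>A mixture of the full index set and a uniformly chosen singleton has the prescribed
  inclusion probabilities.\<close>

lemma exists_random_subset: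
  assumes "d \<ge> 1" "1 / real d \<le> r" "r \<le> 1"
  shows "\<exists>\<sigma> :: nat set pmf. (\<forall>S\<in>set_pmf \<sigma>. S \<inter> {1..d} \<noteq> {}) \<and>
    (\<forall>i\<in>{1..d}. measure_pmf.prob \<sigma> {S. i \<in> S} = r)"
proof -
  \<comment> \<open>\<open>p\<close> is the weight of the singleton, obtained by solving \<open>p / d + (1 - p) = r\<close>. For \<open>d = 1\<close>
    the hypotheses force \<open>r = 1\<close>, and \<open>p = 0\<close> by division by zero, which satisfies the equation.\<close>
  define p where "p = (1 - r) * real d / (real d - 1)"
  have p: "0 \<le> p" "p \<le> 1" and r: "p / real d + (1 - p) = r"
  proof -
    have "0 \<le> p \<and> p \<le> 1 \<and> p / real d + (1 - p) = r"
    proof (cases "d = 1")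
      case True
      then show ?thesis using assms by (simp add: p_def)
    next
      case False
      then have d: "real d - 1 > 0" using assms(1) by simp
      have "1 \<le> r * real d" using assms d by (simp add: field_simps)
      then have "p \<le> 1" using d by (simp add: p_def field_simps)
      moreover have "p / real d + (1 - p) = 1 - p * (real d - 1) / real d"
        using d by (simp add: field_simps)
      moreover have "p * (real d - 1) = (1 - r) * real d" using d by (simp add: p_def)
      moreover have "0 \<le> p" using d assms by (simp add: p_def)
      ultimately show ?thesis using d by simp
    qed
    then show "0 \<le> p" "p \<le> 1" "p / real d + (1 - p) = r" by auto
  qed
  have fin: "finite {1..d}" "{1..d} \<noteq> {}" using assms(1) by auto
  define \<sigma> where "\<sigma> = map_pmf (\<lambda>(b, i). if b then {i} else {1..d})
    (pair_pmf (bernoulli_pmf p) (pmf_of_set {1..d}))"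
  have "measure_pmf.prob \<sigma> {S. i \<in> S} = r" if i: "i \<in> {1..d}" for i
  proof -
    let ?\<tau> = "pair_pmf (bernoulli_pmf p) (pmf_of_set {1..d})"
    have "measure_pmf.prob \<sigma> {S. i \<in> S} = measure_pmf.prob ?\<tau> ({(True, i)} \<union> {False} \<times> {1..d})"
      unfolding \<sigma>_def measure_map_pmf
      using i fin by (intro measure_prob_cong_0) (auto simp: pmf_pair split: if_splits)
    also have "\<dots> = (\<Sum>z\<in>{(True, i)} \<union> {False} \<times> {1..d}. pmf ?\<tau> z)"
      by (rule measure_measure_pmf_finite) simp
    also have "\<dots> = pmf ?\<tau> (True, i) + (\<Sum>j\<in>{1..d}. pmf ?\<tau> (False, j))"
      using sum.cartesian_product[of "\<lambda>b j. pmf ?\<tau> (b, j)" "{1..d}" "{False}"]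
      by (subst sum.union_disjoint) auto
    also have "\<dots> = p / real d + (1 - p)"
      using p fin i assms(1) by (simp add: pmf_pair)
    finally show ?thesis using r by simp
  qed
  moreover have "S \<inter> {1..d} \<noteq> {}" if "S \<in> set_pmf \<sigma>" for S
    using that fin by (auto simp: \<sigma>_def set_pmf_of_set[OF fin(2,1)])
  ultimately show ?thesis by blast
qed

lemma measure_unit_interval_le:
  "measure lborel {w \<in> {0<..<1}. w \<le> c} = max 0 (min 1 (c::real))"
proof -
  consider "c \<le> 0" | "0 < c" "c < 1" | "1 \<le> c" by linarith
  then show ?thesis
  proof cases
    case 1
    then have *: "{w \<in> {0<..<1}. w \<le> c} = {}" by auto
    show ?thesis unfolding * using 1 by simp
  next
    case 2
    then have *: "{w \<in> {0<..<1}. w \<le> c} = {0<..c}" by auto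
    show ?thesis unfolding * using 2 by simp
  next
    case 3
    then have *: "{w \<in> {0<..<1}. w \<le> c} = {0<..<1}" by auto
    show ?thesis unfolding * using 3 by simp
  qed
qed

text \<open>The coordinates are \<open>t + (1 - t) W\<close> or \<open>t W\<close>, according to whether their index lies in the
  random set. The upper part \<open>[t, 1]\<close> and the lower part \<open>[0, t]\<close> are thereby hit with probabilities
  \<open>1 - t\<close> and \<open>t\<close>, equal to their lengths, which makes the marginals uniform.\<close>

lemma exists_law_with_kinked_diagonal:
  assumes d: "d \<ge> 1" and t: "0 \<le> t" "t \<le> 1 - 1 / real d"
  shows "\<exists>Q. law_on_Rd d Q \<and>
    (\<forall>i\<in>{1..d}. distr Q borel (\<lambda>U. U i) = uniform_measure lborel {0..1}) \<and>
    (\<forall>u\<in>{0..1}. joint_cdf d Q (\<lambda>_. u) = max 0 ((u - t) / (1 - t)))"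
proof -
  have t1: "t < 1" using t(2) d by (auto intro: le_less_trans)
  obtain \<sigma> :: "nat set pmf" where
    \<sigma>: "\<forall>S\<in>set_pmf \<sigma>. S \<inter> {1..d} \<noteq> {}" "\<forall>i\<in>{1..d}. measure_pmf.prob \<sigma> {S. i \<in> S} = 1 - t"
    using exists_random_subset[OF d, of "1 - t"] t by force
  define W :: "real measure" where "W = restrict_space lborel {0<..<1}"
  have space_W: "space W = {0<..<1}" by (simp add: W_def space_restrict_space)
  interpret W: prob_space W
    by (auto simp: W_def emeasure_restrict_space space_restrict_space intro!: prob_spaceI)
  have [measurable]: "(\<lambda>w. w) \<in> borel_measurable W"
    by (simp add: W_def measurable_restrict_space1)
  interpret \<sigma>W: pair_prob_space "measure_pmf \<sigma>" W ..
  let ?M = "measure_pmf \<sigma> \<Otimes>\<^sub>M W"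
  have W_le: "measure W {w \<in> space W. w \<le> c} = max 0 (min 1 c)" for c
  proof -
    have "measure W {w \<in> space W. w \<le> c} = measure lborel {w \<in> space W. w \<le> c}"
      unfolding W_def by (rule measure_restrict_space) (auto simp: space_restrict_space)
    then show ?thesis using measure_unit_interval_le[of c] by (simp only: space_W)
  qed
  have W_sets: "{w \<in> space W. w \<le> c} \<in> sets W" for c by measurable
  have prob_Times: "measure ?M (A \<times> B) = measure_pmf.prob \<sigma> A * measure W B"
    if "B \<in> sets W" for A B
    
    using W.emeasure_pair_measure_Times[of A "measure_pmf \<sigma>" B] that
    by (simp add: measure_def enn2real_mult)
  define U where "U = (\<lambda>i (z :: nat set \<times> real).
    if i \<in> fst z then t + (1 - t) * snd z else t * snd z)"
  have U: "U i \<in> borel_measurable ?M" for i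
  proof -
    have snd: "snd \<in> borel_measurable ?M"
      by (rule measurable_compose[OF measurable_snd]) measurable
    have "{z \<in> space ?M. i \<in> fst z} = {S. i \<in> S} \<times> space W"
      by (auto simp: space_pair_measure)
    then have "{z \<in> space ?M. i \<in> fst z} \<in> sets ?M" by simp
    then show ?thesis unfolding U_def 
      by (intro measurable_If borel_measurable_add borel_measurable_times borel_measurable_const snd)
  qed
  have marginal: "distr ?M borel (U i) = uniform_measure lborel {0..1}" if i: "i \<in> {1..d}" for i
  proof (rule cdf_unique)
    show "real_distribution (uniform_measure lborel {0..1::real})"
      by (rule real_distribution_uniform)
    show "real_distribution (distr ?M borel (U i))"
      using \<sigma>W.P.prob_space_distr[OF U] by (simp add: real_distribution_def real_distribution_axioms_def)
    show "cdf (distr ?M borel (U i)) = cdf (uniform_measure lborel {0..1})"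
    proof
      fix u :: real
      let ?B = "{w \<in> space W. t + (1 - t) * w \<le> u}" and ?B' = "{w \<in> space W. t * w \<le> u}"
      have B: "?B = {w \<in> space W. w \<le> (u - t) / (1 - t)}" using t1 by (auto simp: field_simps)
      have sB: "?B \<in> sets W" "?B' \<in> sets W" by measurable
      have B': "t * measure W ?B' = max 0 (min t u)"
      \<comment> \<open>The factor \<open>t\<close> covers the degenerate case \<open>t = 0\<close>, where every index is almost surely in
        the random set.\<close>
      proof (cases "t = 0")
        case False
        then have "?B' = {w \<in> space W. w \<le> u / t}" using t(1) by (auto simp: field_simps)
        then have "measure W ?B' = max 0 (min 1 (u / t))" using W_le by simp
        then show ?thesis using t(1) False by (auto simp: max_def min_def field_simps)
      qed simp
      have compl: "measure_pmf.prob \<sigma> {S. i \<notin> S} = t"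
        using measure_pmf.prob_compl[of "{S. i \<in> S}" \<sigma>] \<sigma>(2) i
        by (simp add: Collect_neg_eq Compl_eq_Diff_UNIV)
      have "cdf (distr ?M borel (U i)) u = measure ?M (U i -` {..u} \<inter> space ?M)"
        by (simp add: cdf_def measure_distr U)
      also have "U i -` {..u} \<inter> space ?M = {S. i \<in> S} \<times> ?B \<union> {S. i \<notin> S} \<times> ?B'"
        by (auto simp: U_def space_pair_measure split: if_splits)
      also have "measure ?M \<dots> = measure ?M ({S. i \<in> S} \<times> ?B) + measure ?M ({S. i \<notin> S} \<times> ?B')"
        using sB by (intro \<sigma>W.P.finite_measure_Union) auto
      also have "\<dots> = (1 - t) * max 0 (min 1 ((u - t) / (1 - t))) + max 0 (min t u)"
        using \<sigma>(2) i compl B' W_le[of "(u - t) / (1 - t)"] sB by (simp add: prob_Times B)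
      also have "\<dots> = max 0 (min 1 u)"
        using t(1) t1 by (auto simp: max_def min_def field_simps)
      also have "\<dots> = cdf (uniform_measure lborel {0..1}) u"
      proof -
        have "{0..1} \<inter> {..u} = {0..min 1 u}" by auto
        then show ?thesis by (simp add: cdf_def measure_uniform_measure)
      qed
      finally show "cdf (distr ?M borel (U i)) u = cdf (uniform_measure lborel {0..1}) u" .
    qed
  qed
  have diagonal: "joint_cdf d (vector_law d ?M U) (\<lambda>_. u) = max 0 ((u - t) / (1 - t))"
    if u: "u \<in> {0..1}" for u
  proof -
    let ?c = "(u - t) / (1 - t)"
    have "AE z in ?M. fst z \<in> set_pmf \<sigma>"
    proof (rule \<sigma>W.AE_pair_measure)
      have "{z \<in> space ?M. fst z \<in> set_pmf \<sigma>} = set_pmf \<sigma> \<times> space W"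
        by (auto simp: space_pair_measure)
      then show "{z \<in> space ?M. fst z \<in> set_pmf \<sigma>} \<in> sets ?M" by simp
    qed (simp add: AE_measure_pmf)
    then have "AE z in ?M. (\<forall>i\<in>{1..d}. U i z \<le> u) \<longleftrightarrow> snd z \<le> ?c"
      using AE_space
    proof eventually_elim
      case (elim z)
      \<comment> \<open>Any index in the random set attains the maximum.\<close>
      then obtain j where j: "j \<in> fst z" "j \<in> {1..d}" using \<sigma>(1) by blast
      have w: "0 < snd z" "snd z < 1" using elim(2) by (auto simp: space_pair_measure space_W)
      have "t * snd z \<le> t" using t(1) w by (simp add: mult_left_le)
      then have "U i z \<le> U j z" for i
        using j t1 w by (auto simp: U_def intro: order_trans)
      then have "(\<forall>i\<in>{1..d}. U i z \<le> u) \<longleftrightarrow> U j z \<le> u" using j(2) order_trans by blast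
      then show ?case using j t1 by (simp add: U_def field_simps)
    qed
    then have "measure ?M {z \<in> space ?M. \<forall>i\<in>{1..d}. U i z \<le> u}
        = measure ?M {z \<in> space ?M. snd z \<le> ?c}"
      using U by (intro \<sigma>W.P.finite_measure_eq_AE) (auto, measurable)
    also have "{z \<in> space ?M. snd z \<le> ?c} = UNIV \<times> {w \<in> space W. w \<le> ?c}"
      by (auto simp: space_pair_measure)
    also have "measure ?M \<dots> = max 0 (min 1 ?c)"
      using prob_Times[OF W_sets] W_le by simp
    also have "min 1 ?c = ?c" using u t1 by (simp add: field_simps)
    finally show ?thesis
      using joint_cdf_vector_law[OF \<sigma>W.P.prob_space_axioms U] by simp
  qed
  show ?thesis
    using law_on_Rd_vector_law[OF \<sigma>W.P.prob_space_axioms U] marginal diagonal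
      distr_coordinate_vector_law[of d U ?M] U by (intro exI[of _ "vector_law d ?M U"]) auto
qed

section \<open>The worst-case probability\<close>

lemma diagonal_section_joint_cdf:
  assumes "u \<in> {0..1}"
  shows "diagonal_section d (restrict (joint_cdf d Q) ({1..d} \<rightarrow>\<^sub>E {0..1})) u = joint_cdf d Q (\<lambda>_. u)"
  using assms by (auto simp: diagonal_section_def intro: joint_cdf_cong)

theorem theorem2:
  fixes d :: nat and F :: "real \<Rightarrow> real" and x \<epsilon> :: real
  assumes "d \<ge> 1"
    and "\<exists>\<mu>. real_distribution \<mu> \<and> F = cdf \<mu>"
    and "\<epsilon> \<ge> 0"
  defines "prob_max \<equiv> \<lambda>P :: (nat \<Rightarrow> real) measure.
      measure P {X \<in> space P. x < Max (X ` {1..d}) \<and> Max (X ` {1..d}) \<le> x + \<epsilon>}"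
    and "bound \<equiv> (F (x + \<epsilon>) - F x) *
      (if F x = 1 then real d else min (1 / (1 - F x)) (real d))"
  shows "(\<exists>P \<in> convex_diagonal_laws d F. prob_max P = bound) \<and>
         (\<forall>P \<in> convex_diagonal_laws d F. prob_max P \<le> bound)"
proof -
  obtain \<mu> where \<mu>: "real_distribution \<mu>" and F: "F = cdf \<mu>" using assms(2) by blast
  interpret \<mu>: real_distribution \<mu> by fact
  define a b where "a = F x" and "b = F (x + \<epsilon>)"
  have F01: "F y \<in> {0..1}" for y using \<mu>.cdf_nonneg \<mu>.cdf_bounded_prob by (simp add: F)
  have ab: "0 \<le> a" "a \<le> b" "b \<le> 1" "a \<le> 1"
    using F01 \<mu>.cdf_nondecreasing \<open>\<epsilon> \<ge> 0\<close> by (auto simp: a_def b_def F)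
  let ?cube = "{1..d} \<rightarrow>\<^sub>E {0..1::real}"
  have prob_max: "prob_max P = joint_cdf d P (\<lambda>_. x + \<epsilon>) - joint_cdf d P (\<lambda>_. x)"
    if "law_on_Rd d P" for P
    unfolding prob_max_def using measure_Max_in_interval[OF that] assms by simp
  have copula_eq: "restrict (joint_cdf d Q) ?cube (\<lambda>i\<in>{1..d}. F (y i)) = joint_cdf d Q (\<lambda>i. F (y i))"
    for Q y
    using F01 by (auto intro: joint_cdf_cong)
  have upper: "prob_max P \<le> bound" if "P \<in> convex_diagonal_laws d F" for P
  proof -
    from that obtain Q where P: "law_on_Rd d P" and Q: "law_on_Rd d Q"
      and unif: "\<forall>i\<in>{1..d}. distr Q borel (\<lambda>U. U i) = uniform_measure lborel {0..1}"
      and conv: "convex_on {0..1} (diagonal_section d (restrict (joint_cdf d Q) ?cube))"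
      and cdf: "\<And>y. joint_cdf d P y = restrict (joint_cdf d Q) ?cube (\<lambda>i\<in>{1..d}. F (y i))"
      unfolding convex_diagonal_laws_def copula_def by blast
    let ?D = "diagonal_section d (restrict (joint_cdf d Q) ?cube)"
    have D: "?D u = joint_cdf d Q (\<lambda>_. u)" if "u \<in> {0..1}" for u
      using diagonal_section_joint_cdf[OF that] .
    have pm: "prob_max P = joint_cdf d Q (\<lambda>_. b) - joint_cdf d Q (\<lambda>_. a)"
      using prob_max[OF P] by (simp only: cdf copula_eq a_def b_def)
    have lip: "prob_max P \<le> (b - a) * real d"
      using joint_cdf_diagonal_lipschitz[OF Q unif ab(1-3)] pm by (simp add: mult.commute)
    have slope: "prob_max P \<le> (b - a) * (1 / (1 - a))" if "a \<noteq> 1"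
    proof -
      have "?D b - ?D a \<le> (b - a) * (1 / (1 - a))"
        using ab that joint_cdf_diagonal_one[OF Q unif]
        by (intro convex_increment_le[OF conv]) (simp_all add: D joint_cdf_def[of d Q "\<lambda>_. a"] del: One_nat_def)
      then show ?thesis using pm ab by (simp add: D del: One_nat_def)
    qed
    show ?thesis
      using lip slope unfolding bound_def a_def[symmetric] b_def[symmetric]
      by (cases "a = 1") (auto simp: min_def)
  qed
  \<comment> \<open>The kink is placed as far right as possible, subject to staying left of \<open>a\<close> and to the slope
    after it being at most \<open>d\<close>.\<close>
  define t where "t = min a (1 - 1 / real d)"
  have t: "0 \<le> t" "t \<le> 1 - 1 / real d" "t \<le> a" using assms(1) ab by (auto simp: t_def)
  have t1: "t < 1" using t(2) assms(1) by (auto intro: le_less_trans)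
  obtain Q where Q: "law_on_Rd d Q"
    and unif: "\<forall>i\<in>{1..d}. distr Q borel (\<lambda>U. U i) = uniform_measure lborel {0..1}"
    and kink: "\<And>u. u \<in> {0..1} \<Longrightarrow> joint_cdf d Q (\<lambda>_. u) = max 0 ((u - t) / (1 - t))"
    using exists_law_with_kinked_diagonal[OF assms(1) t(1,2)] by blast
  obtain P where P: "law_on_Rd d P" and cdf: "\<And>y. joint_cdf d P y = joint_cdf d Q (\<lambda>i. F (y i))"
    using exists_law_with_copula[OF \<mu> Q unif] F by blast
  have "copula d (restrict (joint_cdf d Q) ?cube)"
    using Q unif unfolding copula_def by blast
  moreover have "convex_on {0..1} (diagonal_section d (restrict (joint_cdf d Q) ?cube))"
  proof -
    have "convex_on {0..1} (\<lambda>u. max 0 ((u - t) / (1 - t)))"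
    proof (rule convex_onI)
      fix s y z :: real assume s: "0 < s" "s < 1"
      have "((1 - s) * y + s * z - t) / (1 - t) = (1 - s) * ((y - t) / (1 - t)) + s * ((z - t) / (1 - t))"
      proof -
        have "(1 - s) * y + s * z - t = (1 - s) * (y - t) + s * (z - t)"
          by (simp add: algebra_simps)
        then show ?thesis by (simp add: add_divide_distrib)
      qed
      also have "\<dots> \<le> (1 - s) * max 0 ((y - t) / (1 - t)) + s * max 0 ((z - t) / (1 - t))"
        using s by (intro add_mono mult_left_mono) auto
      finally show "max 0 (((1 - s) *\<^sub>R y + s *\<^sub>R z - t) / (1 - t))
          \<le> (1 - s) * max 0 ((y - t) / (1 - t)) + s * max 0 ((z - t) / (1 - t))"
        using s by simp
    qed simp
    then show ?thesis
      by (rule convex_on_transfer) (simp add: diagonal_section_joint_cdf kink del: One_nat_def)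
  qed
  ultimately have "P \<in> convex_diagonal_laws d F"
    unfolding convex_diagonal_laws_def using P cdf copula_eq by auto
  moreover have "prob_max P = bound"
  proof -
    have "prob_max P = (b - t) / (1 - t) - (a - t) / (1 - t)"
      using prob_max[OF P] kink[of a] kink[of b] ab t(3) t1
      by (simp add: cdf a_def[symmetric] b_def[symmetric])
    also have "\<dots> = (b - a) * (1 / (1 - t))" by (simp add: diff_divide_distrib)
    also have "1 / (1 - t) = (if a = 1 then real d else min (1 / (1 - a)) (real d))"
    proof (cases "a \<le> 1 - 1 / real d")
      case True
      then have "t = a" "a \<noteq> 1" using t1 by (auto simp: t_def)
      moreover have "1 / (1 - a) \<le> real d"
        using True assms(1) t1 \<open>t = a\<close> by (simp add: field_simps)
      ultimately show ?thesis by simp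
    next
      case False
      then have "t = 1 - 1 / real d" by (simp add: t_def)
      moreover have "real d \<le> 1 / (1 - a)" if "a \<noteq> 1"
        using False that ab assms(1) by (simp add: field_simps)
      ultimately show ?thesis by simp
    qed
    finally show ?thesis by (simp add: bound_def a_def b_def)
  qed
  ultimately show ?thesis using upper by blast
qed

end
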